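(* Let $G=(V,E,w,\mu,\kappa)$ be a connected finite weighted graph with $\kappa\geq 0$, and let $\ell=|E|-|V|+1$ be its cyclomatic number. Then for every integer $k$ with $\ell+1\leq k\leq |V|$, $$\rho_{k-\ell}(G)\leq \sqrt{2\tau_G\lambda_k(G)}.$$
   Context: A weighted graph $G=(V,E,w,\mu,\kappa)$ is a finite simple graph without isolated vertices, $V=\{1,\dots,n\}$, with edge weights $w:E\to\mathbb{R}_{>0}$ (write $w_{ij}$), vertex measure $\mu:V\to\mathbb{R}_{>0}$ and potential $\kappa:V\to\mathbb{R}$. The weighted degree is $d(i)=\sum_{j\sim i}w_{ij}$ and $\tau_G=\max_{i\in V} d(i)/\mu_i$. Let $A$ be the weighted adjacency matrix ($a_{ij}=w_{ij}$ if $i\sim j$, $0$ otherwise), $D,K,M$ the diagonal matrices with entries $d(i),\kappa_i,\mu_i$. The normalized Laplacian is $\mathfrak{L}=M^{-1}(D+K-A)$, with eigenvalues (with multiplicity) $\lambda_1(G)\leq\cdots\leq\lambda_n(G)$. For $\emptyset\neq S\subset V$, the conductance is $\Phi_G(S)=\frac{\sum_{i\in S,j\notin S}w_{ij}}{\sum_{i\in S}\mu_i}$. The $k$-way Cheeger constant is $\rho_k(G)=\min\max_{1\leq i\leq k}\Phi_G(A_i)$, the minimum over all $k$-tuples $(A_1,\dots,A_k)$ of nonempty pairwise disjoint subsets of $V$. *)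

theory Defs
  imports
    Complex_Main
    "HOL-Library.FuncSet"
    "HOL-Library.Disjoint_Sets"
    "HOL-Library.Multiset"
    "HOL-Computational_Algebra.Polynomial"
    "Jordan_Normal_Form.Char_Poly"
begin

text \<open>
  The vertices are labelled 0, ..., n - 1 rather than 1, ..., n, so that they coincide with the
  row and column indices of matrices.  An edge is a two-element set of vertices, and edge weights
  are indexed by edges, so symmetry of the weights is built in.
  Values of the weight function outside the edge set, and of the vertex functions outside the
  vertex set, are irrelevant.
\<close>

record wgraph =
  num_verts :: nat
  edges :: "nat set set"
  weight :: "nat set \<Rightarrow> real"
  vmeasure :: "nat \<Rightarrow> real"
  potential :: "nat \<Rightarrow> real"

definition verts :: "wgraph \<Rightarrow> nat set" where
  "verts G = {0..<num_verts G}"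

definition weighted_graph :: "wgraph \<Rightarrow> bool" where
  "weighted_graph G \<longleftrightarrow>
     verts G \<noteq> {} \<and>
     (\<forall>e\<in>edges G. e \<subseteq> verts G \<and> card e = 2) \<and>
     (\<forall>i\<in>verts G. \<exists>j. {i, j} \<in> edges G) \<and>
     (\<forall>e\<in>edges G. weight G e > 0) \<and>
     (\<forall>i\<in>verts G. vmeasure G i > 0)"

definition connected_graph :: "wgraph \<Rightarrow> bool" where
  "connected_graph G \<longleftrightarrow>
     (\<forall>i\<in>verts G. \<forall>j\<in>verts G. (i, j) \<in> {(u, v). {u, v} \<in> edges G}\<^sup>*)"

definition cyclomatic_number :: "wgraph \<Rightarrow> int" where
  "cyclomatic_number G = int (card (edges G)) - int (card (verts G)) + 1"

definition adj_weight :: "wgraph \<Rightarrow> nat \<Rightarrow> nat \<Rightarrow> real" where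
  "adj_weight G i j = (if {i, j} \<in> edges G then weight G {i, j} else 0)"

definition wdegree :: "wgraph \<Rightarrow> nat \<Rightarrow> real" where
  "wdegree G i = (\<Sum>j | {i, j} \<in> edges G. weight G {i, j})"

definition tau :: "wgraph \<Rightarrow> real" where
  "tau G = Max ((\<lambda>i. wdegree G i / vmeasure G i) ` verts G)"

definition adjacency_mat :: "wgraph \<Rightarrow> real mat" where
  "adjacency_mat G = mat (num_verts G) (num_verts G) (\<lambda>(i, j). adj_weight G i j)"

definition degree_mat :: "wgraph \<Rightarrow> real mat" where
  "degree_mat G = mat_diag (num_verts G) (wdegree G)"

definition potential_mat :: "wgraph \<Rightarrow> real mat" where
  "potential_mat G = mat_diag (num_verts G) (potential G)"

definition measure_mat :: "wgraph \<Rightarrow> real mat" where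
  "measure_mat G = mat_diag (num_verts G) (vmeasure G)"

definition measure_mat_inv :: "wgraph \<Rightarrow> real mat" where
  "measure_mat_inv G = mat_diag (num_verts G) (\<lambda>i. 1 / vmeasure G i)"

lemma measure_mat_inv:
  assumes "weighted_graph G"
  shows "inverts_mat (measure_mat G) (measure_mat_inv G)"
    and "inverts_mat (measure_mat_inv G) (measure_mat G)"
proof -
  have "vmeasure G i \<noteq> 0" if "i < num_verts G" for i
    using assms that by (force simp: weighted_graph_def verts_def)
  then show "inverts_mat (measure_mat G) (measure_mat_inv G)"
    and "inverts_mat (measure_mat_inv G) (measure_mat G)"
    by (auto simp: inverts_mat_def measure_mat_def measure_mat_inv_def mat_diag_def[of _ "\<lambda>_. _ / _"]
        intro!: eq_matI)
      (auto simp: mat_diag_def)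
qed

definition normalized_laplacian :: "wgraph \<Rightarrow> real mat" where
  "normalized_laplacian G =
     measure_mat_inv G * (degree_mat G + potential_mat G - adjacency_mat G)"

text \<open>
  The normalized Laplacian is similar to a real symmetric matrix, so its characteristic polynomial
  splits over the reals, and the sorted list of its real roots, repeated according to multiplicity,
  has length n.  The eigenvalues are numbered starting from 1.
\<close>

definition eigenvalue_list :: "wgraph \<Rightarrow> real list" where
  "eigenvalue_list G =
     sorted_list_of_multiset (proots (char_poly (normalized_laplacian G)))"

definition lambda :: "wgraph \<Rightarrow> nat \<Rightarrow> real" where
  "lambda G k = eigenvalue_list G ! (k - 1)"

definition conductance :: "wgraph \<Rightarrow> nat set \<Rightarrow> real" where
  "conductance G S =
     (\<Sum>i\<in>S. \<Sum>j\<in>verts G - S. adj_weight G i j) / (\<Sum>i\<in>S. vmeasure G i)"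

definition disjoint_tuples :: "wgraph \<Rightarrow> nat \<Rightarrow> (nat \<Rightarrow> nat set) set" where
  "disjoint_tuples G k =
     {A \<in> {1..k} \<rightarrow>\<^sub>E (Pow (verts G) - {{}}). disjoint_family_on A {1..k}}"

definition cheeger :: "wgraph \<Rightarrow> nat \<Rightarrow> real" where
  "cheeger G k =
     Min ((\<lambda>A. Max ((\<lambda>i. conductance G (A i)) ` {1..k})) ` disjoint_tuples G k)"

end

theory Submission
  imports Defs "HOL-Analysis.L2_Norm"
begin

text \<open>
  Order the vertices by distance from a root.  Every vertex other than the root has an earlier
  neighbour, so at most \<open>\<ell>\<close> vertices have two or more; deleting this set \<open>F\<close> leaves a forest \<open>W\<close>.
  Let \<open>Q\<close> be the quadratic form of \<open>D + K - A - \<lambda>\<^sub>k M\<close>.  Going through \<open>W\<close> from the latest vertex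
  downwards, cut off the descendants of a vertex \<open>c\<close> as soon as they carry a nonzero function with
  \<open>Q \<le> 0\<close>, and continue with what is left.  This yields a set \<open>C\<close> of cut vertices with disjoint
  sets carrying such functions, while \<open>Q\<close> is positive on the functions vanishing on \<open>F \<union> C\<close>.
  The eigenvectors of \<open>\<lambda>\<^sub>1, \<dots>, \<lambda>\<^sub>k\<close> span a \<open>k\<close>-dimensional space on which \<open>Q \<le> 0\<close>, so
  \<open>\<bar>F\<bar> + \<bar>C\<bar> \<ge> k\<close> and \<open>\<bar>C\<bar> \<ge> k - \<ell>\<close>.  The Cheeger sweep argument turns each of the test functions
  into a set of small conductance inside its support.
\<close>

section \<open>Cutting a forest into test functions\<close>

definition qform :: "'a set \<Rightarrow> ('a \<Rightarrow> 'a \<Rightarrow> real) \<Rightarrow> ('a \<Rightarrow> real) \<Rightarrow> real" where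
  "qform V b f = (\<Sum>i\<in>V. \<Sum>j\<in>V. b i j * f i * f j)"

definition nonzero_supported :: "('a \<Rightarrow> real) \<Rightarrow> 'a set \<Rightarrow> bool" where
  "nonzero_supported f S \<longleftrightarrow> (\<forall>x. f x \<noteq> 0 \<longrightarrow> x \<in> S) \<and> (\<exists>x. f x \<noteq> 0)"

lemma qform_zero: "(\<And>x. f x = 0) \<Longrightarrow> qform V b f = 0"
  by (simp add: qform_def)

text \<open>The mixed terms vanish because \<open>b\<close> does not couple the part of the support
  inside \<open>U\<close> with the part outside. This is how a branch of the forest is
  detached.\<close>

lemma qform_restrict_split:
  assumes sym: "\<And>i j. b i j = b j i"
    and cross: "\<And>i j. i \<in> U \<Longrightarrow> j \<notin> U \<Longrightarrow> f i \<noteq> 0 \<Longrightarrow> f j \<noteq> 0 \<Longrightarrow> b i j = 0"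
  shows "qform V b f =
    qform V b (\<lambda>x. if x \<in> U then f x else 0) + qform V b (\<lambda>x. if x \<in> U then 0 else f x)"
proof -
  have "b i j * f i * f j =
      b i j * (if i \<in> U then f i else 0) * (if j \<in> U then f j else 0) +
      b i j * (if i \<in> U then 0 else f i) * (if j \<in> U then 0 else f j)" for i j
    using cross[of i j] cross[of j i] sym[of i j] by auto
  then show ?thesis
    unfolding qform_def by (simp only: sum.distrib)
qed

text \<open>The cardinality hypothesis says that the nonzero off-diagonal entries of
  \<open>b\<close> form a forest on \<open>W\<close>, where \<open>r\<close> places each parent
  before its children. One branch is removed per induction step, and its top vertex also serves as
  the index of that branch in the family \<open>U\<close>.\<close>

lemma disjoint_test_functions:
  fixes r :: "'a \<Rightarrow> nat"
  assumes sym: "\<And>i j. b i j = b j i"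
    and "finite W" "inj_on r W"
    and "\<And>v. v \<in> W \<Longrightarrow> card {u \<in> W. r u < r v \<and> b u v \<noteq> 0} \<le> 1"
  shows "\<exists>C U. C \<subseteq> W \<and> disjoint_family_on U C \<and>
    (\<forall>c\<in>C. U c \<subseteq> W \<and> (\<exists>f. nonzero_supported f (U c) \<and> qform V b f \<le> 0)) \<and>
    (\<forall>f. nonzero_supported f (W - C) \<longrightarrow> qform V b f > 0)"
  using assms(2-4)
proof (induction W rule: finite_psubset_induct)
  case (psubset W)
  define P where
    "P t \<longleftrightarrow> (\<exists>f. nonzero_supported f {u \<in> W. t \<le> r u} \<and> qform V b f \<le> 0)" for t
  show ?case
  proof (cases "P 0")
    case False
    then have "\<forall>f. nonzero_supported f (W - {}) \<longrightarrow> qform V b f > 0"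
      by (auto simp: P_def not_le)
    then show ?thesis
      by (intro exI[of _ "{}"]) (auto simp: disjoint_family_on_def)
  next
    case True
    have bound: "t \<le> Max (r ` W)" if "P t" for t
    proof -
      from that obtain x where "x \<in> W" "t \<le> r x"
        by (auto simp: P_def nonzero_supported_def)
      then show ?thesis
        using psubset.hyps(1) Max_ge[of "r ` W" "r x"] by (meson finite_imageI imageI order_trans)
    qed
    \<comment> \<open>By maximality of \<open>t\<close>, every nonzero function living on ranks
      strictly above \<open>t\<close> has positive form.\<close>
    define t where "t = (GREATEST t. P t)"
    have Pt: "P t"
      unfolding t_def using True bound by (rule GreatestI_nat)
    have "\<not> P (Suc t)"
      using Greatest_le_nat[of P "Suc t" "Max (r ` W)"] bound by (auto simp: t_def)
    then have pos: "qform V b g > 0" if "nonzero_supported g {u \<in> W. t < r u}" for g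
      using that by (auto simp: P_def not_le Suc_le_eq)
    from Pt obtain f where f: "nonzero_supported f {u \<in> W. t \<le> r u}" "qform V b f \<le> 0"
      by (auto simp: P_def)
    \<comment> \<open>If no vertex had rank \<open>t\<close>, then \<open>f\<close> would already
      live strictly above \<open>t\<close>.\<close>
    have "\<exists>v\<in>W. r v = t"
    proof (rule ccontr)
      assume "\<not> ?thesis"
      then have "{u \<in> W. t \<le> r u} = {u \<in> W. t < r u}"
        by (auto simp: le_less)
      then show False
        using pos[of f] f by auto
    qed
    then obtain v where v: "v \<in> W" "r v = t" by blast
    \<comment> \<open>\<open>R\<close> directs the edges away from the root, so \<open>U\<close>
      consists of \<open>v\<close> and its descendants in \<open>W\<close>.\<close>
    define R where "R = {(x, y). x \<in> W \<and> y \<in> W \<and> r x < r y \<and> b x y \<noteq> 0}"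
    define U where "U = {u. (v, u) \<in> R\<^sup>*}"
    have vU: "v \<in> U" by (simp add: U_def)
    have U_W: "u \<in> W \<and> (u = v \<or> t < r u)" if "u \<in> U" for u
      using that unfolding U_def mem_Collect_eq
      by (induction rule: rtrancl_induct) (auto simp: v R_def)
    have U_closed: "x \<in> U" if "u \<in> U" "x \<in> W" "r u < r x" "b u x \<noteq> 0" for u x
    proof -
      have "(u, x) \<in> R" using that U_W by (auto simp: R_def)
      then show ?thesis using that(1) by (auto simp: U_def)
    qed
    have U_parent: "\<exists>p\<in>U. r p < r u \<and> b p u \<noteq> 0" if "u \<in> U" "u \<noteq> v" for u
    proof -
      from that have "(v, u) \<in> R\<^sup>*" by (simp add: U_def)
      then show ?thesis using that(2)
        by (cases rule: rtranclE) (auto simp: U_def R_def)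
    qed
    \<comment> \<open>The only edge of \<open>W\<close> leaving \<open>U\<close> joins
      \<open>v\<close> to its parent. An outside neighbour \<open>x\<close> of \<open>u\<close> must
      be earlier than \<open>u\<close>, since otherwise it would be a descendant; if
      \<open>u\<close> were not \<open>v\<close>, then \<open>x\<close> and the parent of
      \<open>u\<close> in \<open>U\<close> would be two earlier neighbours.\<close>
    have U_out: "u = v \<and> r x < t" if ux: "u \<in> U" "x \<in> W" "x \<notin> U" "b u x \<noteq> 0" for u x
    proof -
      have "u \<in> W" using ux U_W by blast
      then have "r x \<noteq> r u"
        using ux psubset.prems(1) by (auto dest: inj_onD)
      then have less: "r x < r u" using U_closed[OF ux(1,2)] ux by force
      have "u = v"
      proof (rule ccontr)
        assume "u \<noteq> v"
        then obtain p where p: "p \<in> U" "r p < r u" "b p u \<noteq> 0"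
          using U_parent[OF ux(1)] by blast
        then have "{p, x} \<subseteq> {y \<in> W. r y < r u \<and> b y u \<noteq> 0}"
          using less that sym U_W by auto
        then have "card {p, x} \<le> card {y \<in> W. r y < r u \<and> b y u \<noteq> 0}"
          using psubset.hyps(1) by (intro card_mono) auto
        then have "card {p, x} \<le> 1"
          using psubset.prems(2)[OF \<open>u \<in> W\<close>] by linarith
        then show False using p ux by (cases "p = x") auto
      qed
      then show ?thesis using less v by simp
    qed
    define f1 where "f1 = (\<lambda>x. if x \<in> U then f x else 0)"
    define f2 where "f2 = (\<lambda>x. if x \<in> U then 0 else f x)"
    \<comment> \<open>The support of \<open>f\<close> has ranks at least \<open>t\<close>, while an
      edge leaving \<open>U\<close> ends at a rank below \<open>t\<close>.\<close>
    have sum_f: "qform V b f = qform V b f1 + qform V b f2"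
      unfolding f1_def f2_def
    proof (rule qform_restrict_split[OF sym])
      fix i j assume ij: "i \<in> U" "j \<notin> U" "f i \<noteq> 0" "f j \<noteq> 0"
      then have "j \<in> W" "t \<le> r j" using f(1) by (auto simp: nonzero_supported_def)
      then show "b i j = 0" using U_out[of i j] ij by linarith
    qed
    \<comment> \<open>\<open>f2\<close> vanishes at \<open>v\<close>, the only vertex of rank
      \<open>t\<close>, so its support lies strictly above \<open>t\<close>.\<close>
    have f2_ge: "qform V b f2 > 0" if "\<exists>x. f2 x \<noteq> 0"
    proof (rule pos)
      have "t < r x" if "x \<in> W" "x \<notin> U" "t \<le> r x" for x
        using that v vU psubset.prems(1) by (metis inj_onD le_less)
      then show "nonzero_supported f2 {u \<in> W. t < r u}"
        using that f(1) by (auto simp: nonzero_supported_def f2_def split: if_splits)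
    qed
    \<comment> \<open>If \<open>f1\<close> were zero, \<open>f\<close> would equal \<open>f2\<close>
      and have positive form.\<close>
    have f1: "nonzero_supported f1 U"
    proof -
      have "\<exists>x. f1 x \<noteq> 0"
      proof (rule ccontr)
        assume z: "\<not> ?thesis"
        then have "f2 x = f x" for x unfolding f1_def f2_def by metis
        then have "f2 = f" ..
        moreover have "\<exists>x. f x \<noteq> 0" using f(1) by (auto simp: nonzero_supported_def)
        ultimately show False using f2_ge f(2) by auto
      qed
      then show ?thesis by (auto simp: nonzero_supported_def f1_def split: if_splits)
    qed
    have f1_le: "qform V b f1 \<le> 0"
      using f2_ge qform_zero[of f2 V b] sum_f f(2) by fastforce
    have sub: "W - U \<subset> W" using v vU by blast
    have "card {u \<in> W - U. r u < r x \<and> b u x \<noteq> 0} \<le> 1" if "x \<in> W - U" for x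
    proof -
      have "card {u \<in> W - U. r u < r x \<and> b u x \<noteq> 0} \<le> card {u \<in> W. r u < r x \<and> b u x \<noteq> 0}"
        using psubset.hyps(1) by (intro card_mono) auto
      then show ?thesis using psubset.prems(2)[of x] that by auto
    qed
    then obtain C' U' where C': "C' \<subseteq> W - U" "disjoint_family_on U' C'"
      "\<forall>c\<in>C'. U' c \<subseteq> W - U \<and> (\<exists>f. nonzero_supported f (U' c) \<and> qform V b f \<le> 0)"
      "\<forall>f. nonzero_supported f (W - U - C') \<longrightarrow> qform V b f > 0"
      using psubset.IH[OF sub inj_on_subset[OF psubset.prems(1)]] by auto
    have vC': "v \<notin> C'" using C'(1) vU by blast
    show ?thesis
    proof (intro exI[of _ "insert v C'"] exI[of _ "U'(v := U)"] conjI)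
      show "insert v C' \<subseteq> W" using C'(1) v by blast
      show "disjoint_family_on (U'(v := U)) (insert v C')"
        using C'(2,3) vC' by (fastforce simp: disjoint_family_on_def)
      show "\<forall>c\<in>insert v C'. (U'(v := U)) c \<subseteq> W \<and>
          (\<exists>f. nonzero_supported f ((U'(v := U)) c) \<and> qform V b f \<le> 0)"
      proof
        fix c assume "c \<in> insert v C'"
        then show "(U'(v := U)) c \<subseteq> W \<and>
            (\<exists>f. nonzero_supported f ((U'(v := U)) c) \<and> qform V b f \<le> 0)"
          using C'(3) f1 f1_le U_W by (cases "c = v") auto
      qed
      show "\<forall>g. nonzero_supported g (W - insert v C') \<longrightarrow> qform V b g > 0"
      proof (intro allI impI)
        fix g assume g: "nonzero_supported g (W - insert v C')"
        define g1 where "g1 = (\<lambda>x. if x \<in> U then g x else 0)"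
        define g2 where "g2 = (\<lambda>x. if x \<in> U then 0 else g x)"
        \<comment> \<open>\<open>g\<close> vanishes at \<open>v\<close>, the only vertex of
          \<open>U\<close> with a neighbour in \<open>W\<close> outside \<open>U\<close>, so the two
          pieces do not interact. The piece in \<open>U\<close> is positive by maximality of
          \<open>t\<close>, the other one by the induction hypothesis.\<close>
        have sum_g: "qform V b g = qform V b g1 + qform V b g2"
          unfolding g1_def g2_def
        proof (rule qform_restrict_split[OF sym])
          fix i j assume ij: "i \<in> U" "j \<notin> U" "g i \<noteq> 0" "g j \<noteq> 0"
          then have "i \<noteq> v" "j \<in> W" using g by (auto simp: nonzero_supported_def)
          then show "b i j = 0" using U_out[of i j] ij by blast
        qed
        have g1: "qform V b g1 > 0" if "\<exists>x. g1 x \<noteq> 0"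
        proof (rule pos)
          show "nonzero_supported g1 {u \<in> W. t < r u}"
            using that g U_W by (force simp: nonzero_supported_def g1_def split: if_splits)
        qed
        have g2: "qform V b g2 > 0" if "\<exists>x. g2 x \<noteq> 0"
        proof -
          have "nonzero_supported g2 (W - U - C')"
            using that g by (auto simp: nonzero_supported_def g2_def split: if_splits)
          then show ?thesis using C'(4) by blast
        qed
        obtain x where "g x \<noteq> 0" using g by (auto simp: nonzero_supported_def)
        then have "g1 x \<noteq> 0 \<or> g2 x \<noteq> 0" by (simp add: g1_def g2_def)
        then show "qform V b g > 0"
          using g1 g2 qform_zero[of g1 V b] qform_zero[of g2 V b] sum_g
          by (metis add.left_neutral add.right_neutral add_pos_pos)
      qed
    qed
  qed
qed

section \<open>The spectral theorem for real symmetric matrices\<close>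

text \<open>For an eigenvector \<open>x\<close> the Hermitian form \<open>s\<close> of
  \<open>B\<close> at \<open>x\<close> is real by symmetry and equals \<open>z\<close> times the
  squared norm of \<open>x\<close>.\<close>

lemma symmetric_real_eigenvalue:
  fixes B :: "real mat"
  assumes B: "B \<in> carrier_mat n n" and sym: "B\<^sup>T = B"
    and root: "poly (char_poly (map_mat complex_of_real B)) z = 0"
  shows "Im z = 0"
proof -
  let ?B = "map_mat complex_of_real B"
  have cB: "?B \<in> carrier_mat n n" using B by simp
  obtain x where x: "x \<in> carrier_vec n" "x \<noteq> 0\<^sub>v n" "?B *\<^sub>v x = z \<cdot>\<^sub>v x"
    using root eigenvalue_root_char_poly[OF cB] B by (auto simp: eigenvalue_def eigenvector_def)
  have symB: "B $$ (i, j) = B $$ (j, i)" if "i < n" "j < n" for i j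
    using that B sym by (metis carrier_matD index_transpose_mat(1))
  have eig: "(\<Sum>j<n. of_real (B $$ (i, j)) * x $ j) = z * x $ i" if "i < n" for i
  proof -
    have "(?B *\<^sub>v x) $ i = (\<Sum>j<n. of_real (B $$ (i, j)) * x $ j)"
      using that x(1) B by (simp add: scalar_prod_def atLeast0LessThan)
    then show ?thesis using x that by simp
  qed
  define s where "s = (\<Sum>i<n. \<Sum>j<n. cnj (x $ i) * (of_real (B $$ (i, j)) * x $ j))"
  define N where "N = (\<Sum>i<n. (cmod (x $ i))\<^sup>2)"
  have "s = z * of_real N"
  proof -
    have "s = (\<Sum>i<n. cnj (x $ i) * (z * x $ i))"
      unfolding s_def by (simp add: eig flip: sum_distrib_left)
    also have "\<dots> = z * of_real N"
      unfolding N_def of_real_sum sum_distrib_left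
      by (intro sum.cong) (simp_all add: complex_norm_square ac_simps del: of_real_power)
    finally show ?thesis .
  qed
  moreover have "cnj s = s"
  proof -
    have "cnj s = (\<Sum>i<n. \<Sum>j<n. cnj (x $ j) * (of_real (B $$ (j, i)) * x $ i))"
      unfolding s_def cnj_sum by (intro sum.cong) (simp_all add: symB ac_simps)
    also have "\<dots> = s" unfolding s_def by (rule sum.swap)
    finally show ?thesis .
  qed
  moreover have "N > 0"
  proof -
    obtain i where "i < n" "x $ i \<noteq> 0" using x(1,2) by (auto simp: vec_eq_iff)
    then show ?thesis unfolding N_def by (intro sum_pos2[of _ i]) auto
  qed
  ultimately have "cnj z * of_real N = z * of_real N" by simp
  then have "cnj z = z" using \<open>N > 0\<close> by simp
  then show ?thesis by (simp add: complex_eq_iff)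
qed

text \<open>Factor over the complex numbers, observe that all roots are real, and pull the
  factorization back along the injective embedding of real polynomials.\<close>

lemma symmetric_char_poly_splits:
  fixes B :: "real mat"
  assumes B: "B \<in> carrier_mat n n" and sym: "B\<^sup>T = B"
  shows "\<exists>es. char_poly B = (\<Prod>e\<leftarrow>es. [:- e, 1:])"
proof -
  let ?B = "map_mat complex_of_real B"
  obtain as where as: "char_poly ?B = (\<Prod>a\<leftarrow>as. [:- a, 1:])"
    using char_poly_factorized[of ?B n] B by auto
  have "Im a = 0" if "a \<in> set as" for a
    using that by (intro symmetric_real_eigenvalue[OF assms]) (simp only: as poly_prod_list prod_list_zero_iff, auto)
  then have "map (\<lambda>a. complex_of_real (Re a)) as = as"
    by (intro map_idI) (simp add: complex_eq_iff)
  then have "char_poly ?B = (\<Prod>a\<leftarrow>map (\<lambda>a. complex_of_real (Re a)) as. [:- a, 1:])"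
    using as by simp
  also have "\<dots> = (\<Prod>a\<leftarrow>as. [:- complex_of_real (Re a), 1:])"
    by (simp only: map_map o_def)
  also have "\<dots> = map_poly complex_of_real (\<Prod>e\<leftarrow>map Re as. [:- e, 1:])"
  proof -
    interpret hom: map_poly_comm_ring_hom complex_of_real ..
    show ?thesis by (simp only: hom.hom_prod_list map_map o_def) simp
  qed
  finally have "map_poly complex_of_real (char_poly B) =
      map_poly complex_of_real (\<Prod>e\<leftarrow>map Re as. [:- e, 1:])"
    by (simp only: of_real_hom.char_poly_hom[OF B])
  moreover have "p = q" if "map_poly complex_of_real p = map_poly complex_of_real q" for p q
    using that by (auto simp: poly_eq_iff coeff_map_poly)
  ultimately have "char_poly B = (\<Prod>e\<leftarrow>map Re as. [:- e, 1:])"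
    by blast
  then show ?thesis by blast
qed

text \<open>\<open>W\<close> is the reflection exchanging \<open>v\<close> with the first unit
  vector. The sign condition on \<open>v $ 0\<close> keeps the two vectors apart, so that the
  normalizing denominator cannot vanish.\<close>

lemma householder_reflection:
  fixes v :: "real vec"
  assumes v: "v \<in> carrier_vec n" and "n > 0" and unit: "v \<bullet> v = 1" and neg: "v $ 0 \<le> 0"
  shows "\<exists>W\<in>carrier_mat n n. W\<^sup>T = W \<and> W * W = 1\<^sub>m n \<and> W *\<^sub>v unit_vec n 0 = v"
proof -
  define u where "u i = v $ i - (if i = 0 then 1 else 0)" for i
  \<comment> \<open>Since \<open>v\<close> is a unit vector, \<open>u\<close> has squared norm
    \<open>2 - 2 * v $ 0\<close>, so \<open>c\<close> is 2 divided by that squared norm.\<close>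
  define c where "c = 1 / (1 - v $ 0)"
  define W where "W = mat n n (\<lambda>(i, j). (if i = j then 1 else 0) - c * u i * u j)"
  have W: "W \<in> carrier_mat n n" by (simp add: W_def)
  have "(\<Sum>k<n. (u k)\<^sup>2) = (\<Sum>k<n. v $ k * v $ k) - 2 * v $ 0 + 1"
  proof -
    have "(u k)\<^sup>2 = v $ k * v $ k + (if k = 0 then 1 - 2 * v $ 0 else 0)" for k
      by (simp add: u_def power2_eq_square algebra_simps)
    then show ?thesis using \<open>n > 0\<close> by (simp add: sum.distrib)
  qed
  also have "(\<Sum>k<n. v $ k * v $ k) = 1"
    using unit v by (simp add: scalar_prod_def atLeast0LessThan)
  finally have u2: "c * (\<Sum>k<n. (u k)\<^sup>2) = 2"
    using neg by (simp add: c_def field_simps)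
  have "W\<^sup>T = W" by (rule eq_matI) (auto simp: W_def)
  moreover have "W * W = 1\<^sub>m n"
  proof (rule eq_matI)
    fix i j assume ij: "i < dim_row (1\<^sub>m n :: real mat)" "j < dim_col (1\<^sub>m n :: real mat)"
    have "(W * W) $$ (i, j) =
        (\<Sum>k<n. ((if i = k then 1 else 0) - c * u i * u k) * ((if k = j then 1 else 0) - c * u k * u j))"
      using ij by (simp add: W_def scalar_prod_def atLeast0LessThan)
    also have "\<dots> = (\<Sum>k<n. (if k = i then (if i = j then 1 else 0) - c * u i * u j else 0) +
        ((if k = j then - c * u i * u j else 0) + c * u i * u j * c * (u k)\<^sup>2))"
      by (intro sum.cong) (auto simp: algebra_simps power2_eq_square)
    also have "\<dots> = (if i = j then 1 else 0) - 2 * c * u i * u j + c * u i * u j * (c * (\<Sum>k<n. (u k)\<^sup>2))"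
      using ij by (simp add: sum.distrib sum_distrib_left algebra_simps)
    also have "\<dots> = 1\<^sub>m n $$ (i, j)"
      unfolding u2 using ij by simp
    finally show "(W * W) $$ (i, j) = 1\<^sub>m n $$ (i, j)" .
  qed (use W in auto)
  moreover have "W *\<^sub>v unit_vec n 0 = v"
  proof (rule eq_vecI)
    fix i assume i: "i < dim_vec v"
    have "(W *\<^sub>v unit_vec n 0) $ i = W $$ (i, 0)"
      using i v W \<open>n > 0\<close> by simp
    also have "\<dots> = v $ i"
    proof -
      have "c * u 0 = - 1"
        using neg by (simp add: c_def u_def field_simps)
      then have "c * u i * u 0 = - u i"
        by (metis mult.assoc mult.commute mult_minus1)
      then show ?thesis
        using i v \<open>n > 0\<close> by (simp add: W_def) (simp add: u_def)
    qed
    finally show "(W *\<^sub>v unit_vec n 0) $ i = v $ i" .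
  qed (use W v in auto)
  ultimately show ?thesis using W by blast
qed

text \<open>Eigenvectors may be rescaled and negated, which supplies the normalization and the sign
  needed by \<open>householder_reflection\<close>.\<close>

lemma unit_eigenvector_exists:
  fixes B :: "real mat"
  assumes B: "B \<in> carrier_mat n n" and root: "poly (char_poly B) e = 0"
  shows "\<exists>v\<in>carrier_vec n. B *\<^sub>v v = e \<cdot>\<^sub>v v \<and> v \<bullet> v = 1 \<and> v $ 0 \<le> 0"
proof -
  obtain x where x: "x \<in> carrier_vec n" "x \<noteq> 0\<^sub>v n" "B *\<^sub>v x = e \<cdot>\<^sub>v x"
    using root eigenvalue_root_char_poly[OF B] B by (auto simp: eigenvalue_def eigenvector_def)
  have xx: "x \<bullet> x > 0"
    using x(2) conjugate_square_greater_0_vec[OF x(1)] by simp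
  define c where "c = (if x $ 0 \<le> 0 then 1 else - 1) / sqrt (x \<bullet> x)"
  have "n \<noteq> 0" using x(1,2) by auto
  show ?thesis
  proof (intro bexI[of _ "c \<cdot>\<^sub>v x"] conjI)
    show "B *\<^sub>v (c \<cdot>\<^sub>v x) = e \<cdot>\<^sub>v (c \<cdot>\<^sub>v x)"
      using x B by (simp add: mult_mat_vec[OF B] smult_smult_assoc mult.commute)
    have "c * c = 1 / (x \<bullet> x)"
      using xx by (auto simp: c_def)
    then show "(c \<cdot>\<^sub>v x) \<bullet> (c \<cdot>\<^sub>v x) = 1"
      using xx x(1) by (simp add: mult.assoc[symmetric])
    show "(c \<cdot>\<^sub>v x) $ 0 \<le> 0"
      using x(1) \<open>n \<noteq> 0\<close> xx by (auto simp: c_def divide_simps)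
  qed (use x in auto)
qed

text \<open>Deflation: a reflection moves an eigenvector for the first root to the first coordinate,
  and the induction continues on the complementary block. The diagonal follows the order of the
  given factorization, so a sorted spectrum can be prescribed.\<close>

theorem real_spectral_theorem:
  fixes B :: "real mat"
  assumes "B \<in> carrier_mat n n" and "B\<^sup>T = B"
    and "char_poly B = (\<Prod>e\<leftarrow>es. [:- e, 1:])"
  shows "\<exists>P\<in>carrier_mat n n. P\<^sup>T * P = 1\<^sub>m n \<and> P\<^sup>T * B * P = mat_diag n (\<lambda>i. es ! i)"
  using assms
proof (induction es arbitrary: n B)
  case Nil
  then have "n = 0" using degree_monic_char_poly[of B n] by simp
  then show ?case using Nil by (intro bexI[of _ "1\<^sub>m 0"]) (auto intro!: eq_matI simp: mat_diag_def)
next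
  case (Cons e es)
  have B: "B \<in> carrier_mat n n" by fact
  have cp: "char_poly B = [:- e, 1:] * (\<Prod>e\<leftarrow>es. [:- e, 1:])"
    using Cons.prems(3) by simp
  then have "poly (char_poly B) e = 0" by simp
  from unit_eigenvector_exists[OF B this] obtain v where
    v: "v \<in> carrier_vec n" "B *\<^sub>v v = e \<cdot>\<^sub>v v" "v \<bullet> v = 1" "v $ 0 \<le> 0" by blast
  have "n > 0" using v by (cases n) (auto simp: scalar_prod_def)
  then obtain m where n: "n = 1 + m" by (cases n) auto
  obtain W where W: "W \<in> carrier_mat n n" and W_sym: "W\<^sup>T = W" and WW: "W * W = 1\<^sub>m n"
    and We: "W *\<^sub>v unit_vec n 0 = v"
    using householder_reflection[OF v(1) \<open>n > 0\<close> v(3,4)] by blast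
  define A where "A = W * B * W"
  have A: "A \<in> carrier_mat n n" using W B by (simp add: A_def)
  have A_sym: "A\<^sup>T = A"
    unfolding A_def using W B
    by (simp add: transpose_mult[of _ n n _ n] W_sym Cons.prems(2) assoc_mult_mat[of _ n n _ n _ n])
  have entries_sym: "A $$ (i, j) = A $$ (j, i)" if "i < n" "j < n" for i j
    using that A A_sym by (metis carrier_matD index_transpose_mat(1))
  have "W *\<^sub>v v = unit_vec n 0"
    unfolding We[symmetric] using W WW by (simp flip: assoc_mult_mat_vec)
  then have "A *\<^sub>v unit_vec n 0 = e \<cdot>\<^sub>v unit_vec n 0"
    unfolding A_def using W B v We
    by (simp add: assoc_mult_mat_vec[of _ n n _ n] mult_mat_vec[OF W])
  \<comment> \<open>The first column is \<open>e\<close> times the first unit vector. By symmetry so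
    is the first row, which gives the block form.\<close>
  then have col0: "A $$ (i, 0) = (if i = 0 then e else 0)" if "i < n" for i
    using that A \<open>n > 0\<close> by (auto dest: arg_cong[where f = "\<lambda>x. x $ i"])
  define A1 where "A1 = mat 1 1 (\<lambda>_. e)"
  define A3 where "A3 = mat m m (\<lambda>(i, j). A $$ (Suc i, Suc j))"
  have A1: "A1 \<in> carrier_mat 1 1" and A3: "A3 \<in> carrier_mat m m"
    by (simp_all add: A1_def A3_def)
  have block: "A = four_block_mat A1 (0\<^sub>m 1 m) (0\<^sub>m m 1) A3"
    using A col0 entries_sym unfolding n
    by (intro eq_matI) (auto simp: A1_def A3_def)
  have "A3\<^sup>T = A3"
    using entries_sym by (intro eq_matI) (auto simp: A3_def n)
  moreover have "char_poly A3 = (\<Prod>e\<leftarrow>es. [:- e, 1:])"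
  proof -
    have "similar_mat A B"
      using W B A WW by (auto simp: similar_mat_def A_def intro!: exI similar_mat_witI[of _ _ n])
    then have "char_poly A = [:- e, 1:] * (\<Prod>e\<leftarrow>es. [:- e, 1:])"
      using char_poly_similar cp by metis
    moreover have "char_poly A = char_poly A1 * char_poly A3"
      unfolding block by (rule char_poly_four_block_zeros_col[OF A1 _ A3]) simp
    moreover have "char_poly A1 = [:- e, 1:]"
      by (simp add: A1_def char_poly_defs det_def sign_def)
    ultimately show ?thesis
      by (metis mult_cancel_left pCons_eq_0_iff zero_neq_one)
  qed
  ultimately obtain Q where Q: "Q \<in> carrier_mat m m" "Q\<^sup>T * Q = 1\<^sub>m m"
    "Q\<^sup>T * A3 * Q = mat_diag m (\<lambda>i. es ! i)"
    using Cons.IH[OF A3] by blast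
  define R where "R = four_block_mat (1\<^sub>m 1) (0\<^sub>m 1 m) (0\<^sub>m m 1) Q"
  have R: "R \<in> carrier_mat n n" unfolding R_def n using Q by (intro four_block_carrier_mat) auto
  have RT: "R\<^sup>T = four_block_mat (1\<^sub>m 1) (0\<^sub>m 1 m) (0\<^sub>m m 1) (Q\<^sup>T)"
    unfolding R_def using Q(1)
    by (subst transpose_four_block_mat[of _ 1 1 _ m _ m]) (auto intro!: arg_cong4[of _ _ _ _ _ _ _ _ four_block_mat] eq_matI)
  have QT: "Q\<^sup>T \<in> carrier_mat m m" using Q by simp
  have RR: "R\<^sup>T * R = 1\<^sub>m n"
    unfolding RT unfolding R_def using Q QT
    by (subst mult_four_block_mat[of _ 1 1 _ m _ m _ _ 1 _ m]) (auto simp: n intro!: eq_matI)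
  have "R\<^sup>T * A = four_block_mat A1 (0\<^sub>m 1 m) (0\<^sub>m m 1) (Q\<^sup>T * A3)"
    unfolding RT unfolding block using QT A1 A3
    by (subst mult_four_block_mat[of _ 1 1 _ m _ m _ _ 1 _ m]) auto
  then have "R\<^sup>T * A * R = four_block_mat A1 (0\<^sub>m 1 m) (0\<^sub>m m 1) (Q\<^sup>T * A3 * Q)"
    unfolding R_def using Q(1) QT A1 A3
    by (simp only:, subst mult_four_block_mat[of _ 1 1 _ m _ m _ _ 1 _ m]) auto
  also have "\<dots> = mat_diag n (\<lambda>i. (e # es) ! i)"
    unfolding Q(3) by (rule eq_matI) (auto simp: n A1_def mat_diag_def nth_Cons')
  finally have diag: "R\<^sup>T * A * R = mat_diag n (\<lambda>i. (e # es) ! i)" .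
  show ?case
  proof (intro bexI[of _ "W * R"] conjI)
    have T: "(W * R)\<^sup>T = R\<^sup>T * W"
      using W R W_sym by (simp add: transpose_mult)
    have RT': "R\<^sup>T \<in> carrier_mat n n" using R by simp
    have "(W * R)\<^sup>T * (W * R) = R\<^sup>T * (W * W) * R"
      unfolding T using W R RT' by (simp add: assoc_mult_mat[of _ n n _ n _ n])
    then show "(W * R)\<^sup>T * (W * R) = 1\<^sub>m n"
      using WW RR R RT' by simp
    have "(W * R)\<^sup>T * B * (W * R) = R\<^sup>T * A * R"
      unfolding T A_def using W R B RT' by (simp add: assoc_mult_mat[of _ n n _ n _ n])
    then show "(W * R)\<^sup>T * B * (W * R) = mat_diag n (\<lambda>i. (e # es) ! i)"
      using diag by simp
  qed (use W R in simp)
qed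

section \<open>Variational bound for the k-th eigenvalue\<close>

text \<open>There are fewer equations than unknowns: padded with zero rows, the system has a square
  matrix of determinant 0.\<close>

lemma exists_nontrivial_solution:
  fixes a :: "'a \<Rightarrow> nat \<Rightarrow> 'b :: field"
  assumes "finite C" "card C < k"
  shows "\<exists>c. (\<exists>i<k. c i \<noteq> 0) \<and> (\<forall>v\<in>C. (\<Sum>i<k. a v i * c i) = 0)"
proof -
  obtain xs where xs: "set xs = C" "length xs = card C"
    using finite_distinct_list[OF assms(1)] by (auto simp: distinct_card[symmetric])
  define c where "c r = vec k (\<lambda>i. if r < length xs then a (xs ! r) i else 0)" for r
  \<comment> \<open>Row \<open>k - 1\<close> is zero anyway because \<open>card C < k\<close>; it is
    singled out to match the form of \<open>det_row_0\<close>.\<close>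
  define N where "N = mat\<^sub>r k k (\<lambda>r. if r = k - 1 then 0\<^sub>v k else c r)"
  have N: "N \<in> carrier_mat k k" by (simp add: N_def)
  have "det N = 0"
    unfolding N_def using assms(2) by (intro det_row_0) (auto simp: c_def)
  then obtain v where v: "v \<in> carrier_vec k" "v \<noteq> 0\<^sub>v k" "N *\<^sub>v v = 0\<^sub>v k"
    using det_0_iff_vec_prod_zero_field[OF N] by blast
  show ?thesis
  proof (intro exI[of _ "\<lambda>i. v $ i"] conjI ballI)
    show "\<exists>i<k. v $ i \<noteq> 0"
      using v(1,2) by (metis eq_vecI carrier_vecD index_zero_vec)
    fix w assume "w \<in> C"
    then obtain r where r: "r < length xs" "w = xs ! r"
      using xs by (metis in_set_conv_nth)
    then have rk: "r < k" "r \<noteq> k - 1" using xs assms(2) by auto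
    have "(N *\<^sub>v v) $ r = (\<Sum>i<k. a w i * v $ i)"
      using v(1) rk r by (simp add: N_def c_def scalar_prod_def atLeast0LessThan)
    then show "(\<Sum>i<k. a w i * v $ i) = 0" using v(3) rk by simp
  qed
qed

text \<open>This is one half of the Courant-Fischer principle. On the span of the first
  \<open>k\<close> eigenvectors the Rayleigh quotient is at most the k-th eigenvalue, and fewer than
  \<open>k\<close> vanishing conditions leave a nonzero vector in that span.\<close>

lemma small_quadratic_form_vanishing_on:
  fixes B :: "real mat"
  assumes B: "B \<in> carrier_mat n n" and sym: "B\<^sup>T = B"
    and C: "C \<subseteq> {..<n}" "card C < k" and "k \<le> n"
  defines "es \<equiv> sorted_list_of_multiset (proots (char_poly B))"
  shows "\<exists>x. (\<exists>i<n. x i \<noteq> 0) \<and> (\<forall>i\<in>C. x i = 0) \<and>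
    (\<Sum>i<n. \<Sum>j<n. B $$ (i, j) * x i * x j) \<le> es ! (k - 1) * (\<Sum>i<n. (x i)\<^sup>2)"
proof -
  obtain es' where es': "char_poly B = (\<Prod>e\<leftarrow>es'. [:- e, 1:])"
    using symmetric_char_poly_splits[OF B sym] by blast
  \<comment> \<open>This identifies the sorted root list \<open>es\<close> with the linear factors
    up to order, so \<open>es\<close> itself factorizes the characteristic polynomial.\<close>
  have "proots (\<Prod>e\<leftarrow>xs. [:- e, 1:]) = mset xs" for xs :: "real list"
  proof (induction xs)
    case (Cons x xs)
    have "(\<Prod>e\<leftarrow>xs. [:- e, 1:]) \<noteq> 0" by (auto simp: prod_list_zero_iff)
    then show ?case
      using Cons proots_mult[of "[:- x, 1:]"] by (simp del: mult_pCons_left)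
  qed simp
  then have es: "mset es = mset es'" by (simp add: es_def es')
  then have cp: "char_poly B = (\<Prod>e\<leftarrow>es. [:- e, 1:])"
    unfolding es' by (metis mset_map prod_mset_prod_list)
  have "sorted es" by (simp add: es_def)
  have "length es = n"
    using degree_monic_char_poly[OF B] degree_linear_factors[of uminus es] cp by simp
  obtain P where P: "P \<in> carrier_mat n n" "P\<^sup>T * P = 1\<^sub>m n"
    "P\<^sup>T * B * P = mat_diag n (\<lambda>i. es ! i)"
    using real_spectral_theorem[OF B sym cp] by blast
  have "finite C" using C(1) finite_subset by blast
  then obtain c where c: "\<exists>i<k. c i \<noteq> 0" "\<forall>v\<in>C. (\<Sum>i<k. P $$ (v, i) * c i) = 0"
    using exists_nontrivial_solution[of C k "\<lambda>v i. P $$ (v, i)"] C(2) by blast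
  \<comment> \<open>\<open>y\<close> holds the coordinates in the eigenbasis, zero from index
    \<open>k\<close> on.\<close>
  define y where "y = vec n (\<lambda>i. if i < k then c i else 0)"
  define x where "x = P *\<^sub>v y"
  have y: "y \<in> carrier_vec n" by (simp add: y_def)
  have x: "x \<in> carrier_vec n" using P y by (simp add: x_def)
  have PT: "P\<^sup>T \<in> carrier_mat n n" using P by simp
  have pull: "(P *\<^sub>v y) \<bullet> z = y \<bullet> (P\<^sup>T *\<^sub>v z)" if "z \<in> carrier_vec n" for z
    using transpose_vec_mult_scalar[OF P(1) y that] that y PT
    by (metis comm_scalar_prod mult_mat_vec_carrier P(1))
  have xx: "x \<bullet> x = y \<bullet> y"
    using pull[OF x] P(1,2) PT y unfolding x_def by (simp flip: assoc_mult_mat_vec)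
  have xBx: "x \<bullet> (B *\<^sub>v x) = y \<bullet> (mat_diag n (\<lambda>i. es ! i) *\<^sub>v y)"
  proof -
    have "x \<bullet> (B *\<^sub>v x) = y \<bullet> (P\<^sup>T *\<^sub>v (B *\<^sub>v (P *\<^sub>v y)))"
      using pull[of "B *\<^sub>v x"] B x by (simp add: x_def)
    also have "P\<^sup>T *\<^sub>v (B *\<^sub>v (P *\<^sub>v y)) = (P\<^sup>T * B * P) *\<^sub>v y"
      using P(1) PT B y by (simp add: assoc_mult_mat_vec[of _ n n _ n])
    finally show ?thesis by (simp add: P(3))
  qed
  have yy: "y \<bullet> y = (\<Sum>i<n. (y $ i)\<^sup>2)" and xx': "x \<bullet> x = (\<Sum>i<n. (x $ i)\<^sup>2)"
    using x y by (auto simp: scalar_prod_def atLeast0LessThan power2_eq_square)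
  have "y \<bullet> (mat_diag n (\<lambda>i. es ! i) *\<^sub>v y) = (\<Sum>i<n. es ! i * (y $ i)\<^sup>2)"
  proof -
    have "(mat_diag n (\<lambda>i. es ! i) *\<^sub>v y) $ i = es ! i * y $ i" if "i < n" for i
      using that y
      by (simp add: mat_diag_def scalar_prod_def atLeast0LessThan if_distrib[where f = "\<lambda>z. z * _"]
          cong: if_cong)
    then show ?thesis
      using y by (simp add: scalar_prod_def atLeast0LessThan power2_eq_square ac_simps mat_diag_def)
  qed
  \<comment> \<open>Coordinates from index \<open>k\<close> on vanish; below \<open>k\<close>,
    sortedness gives the bound by entry \<open>k - 1\<close>, the k-th eigenvalue because lists
    start at index 0.\<close>
  also have "\<dots> \<le> (\<Sum>i<n. es ! (k - 1) * (y $ i)\<^sup>2)"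
  proof (rule sum_mono)
    fix i assume "i \<in> {..<n}"
    then show "es ! i * (y $ i)\<^sup>2 \<le> es ! (k - 1) * (y $ i)\<^sup>2"
      using sorted_nth_mono[OF \<open>sorted es\<close>, of i "k - 1"] \<open>length es = n\<close> \<open>k \<le> n\<close>
      by (cases "i < k") (auto simp: y_def intro!: mult_right_mono)
  qed
  finally have le: "x \<bullet> (B *\<^sub>v x) \<le> es ! (k - 1) * (\<Sum>i<n. (x $ i)\<^sup>2)"
    using xBx xx xx' yy by (simp add: sum_distrib_left)
  show ?thesis
  proof (intro exI[of _ "\<lambda>i. x $ i"] conjI ballI)
    obtain i where "i < k" "c i \<noteq> 0" using c(1) by blast
    then have "(\<Sum>i<n. (y $ i)\<^sup>2) > 0"
      using \<open>k \<le> n\<close> by (intro sum_pos2[of _ i]) (auto simp: y_def)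
    then show "\<exists>i<n. x $ i \<noteq> 0"
      using xx xx' yy by (metis (mono_tags, lifting) lessThan_iff less_irrefl sum.neutral zero_power2)
    show "x $ v = 0" if "v \<in> C" for v
    proof -
      have "v < n" using that C(1) by blast
      then have "x $ v = (\<Sum>i<n. P $$ (v, i) * y $ i)"
        using P(1) y by (auto simp: x_def scalar_prod_def atLeast0LessThan)
      also have "\<dots> = (\<Sum>i<k. P $$ (v, i) * c i)"
        using \<open>k \<le> n\<close> by (intro sum.mono_neutral_cong_right) (auto simp: y_def)
      finally show ?thesis using c(2) that by simp
    qed
    have "x \<bullet> (B *\<^sub>v x) = (\<Sum>i<n. \<Sum>j<n. B $$ (i, j) * x $ i * x $ j)"
      using x B by (auto simp: scalar_prod_def atLeast0LessThan sum_distrib_left ac_simps intro!: sum.cong)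
    then show "(\<Sum>i<n. \<Sum>j<n. B $$ (i, j) * x $ i * x $ j) \<le> es ! (k - 1) * (\<Sum>i<n. (x $ i)\<^sup>2)"
      using le by simp
  qed
qed

section \<open>The Cheeger inequality on a subset\<close>

text \<open>Layer-cake argument: subtract the smallest positive value of \<open>g\<close> on its support.\<close>
lemma coarea_inequality:
  fixes a :: "'a \<Rightarrow> 'a \<Rightarrow> real"
  assumes "finite V" "U \<subseteq> V" "\<And>i j. a i j = a j i"
    and cut: "\<And>S. S \<subseteq> U \<Longrightarrow> S \<noteq> {} \<Longrightarrow> h * sum m S \<le> (\<Sum>i\<in>S. \<Sum>j\<in>V - S. a i j)"
    and "\<And>i. g i \<ge> 0" "{i. g i \<noteq> 0} \<subseteq> U"
  shows "2 * h * (\<Sum>i\<in>V. m i * g i) \<le> (\<Sum>i\<in>V. \<Sum>j\<in>V. a i j * \<bar>g i - g j\<bar>)"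
  using assms(5,6)
proof (induction "card {i. g i \<noteq> 0}" arbitrary: g rule: less_induct)
  case less
  define S where "S = {i. g i \<noteq> 0}"
  have S: "S \<subseteq> U" "finite S"
    using less.prems(2) assms(1,2) by (auto simp: S_def intro: finite_subset)
  show ?case
  proof (cases "S = {}")
    case True
    then show ?thesis by (simp add: S_def)
  next
    case False
    define c where "c = Min (g ` S)"
    have c_in: "c \<in> g ` S" using S False by (simp add: c_def)
    have c_le: "c \<le> g i" if "i \<in> S" for i using S that by (simp add: c_def)
    have c_pos: "c > 0" using c_in less.prems(1) by (force simp: S_def less_le)
    define g' where "g' = (\<lambda>i. if i \<in> S then g i - c else 0)"
    \<comment> \<open>The points where \<open>g\<close> attains \<open>c\<close> drop out of the
      support, so the induction applies to \<open>g'\<close>.\<close>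
    have "{i. g' i \<noteq> 0} \<subset> S"
      using c_in by (auto simp: g'_def)
    then have "card {i. g' i \<noteq> 0} < card {i. g i \<noteq> 0}"
      using S by (simp add: psubset_card_mono flip: S_def)
    moreover have "g' i \<ge> 0" for i
      using c_le by (simp add: g'_def)
    moreover have "{i. g' i \<noteq> 0} \<subseteq> U"
      using S by (auto simp: g'_def)
    ultimately have IH:
      "2 * h * (\<Sum>i\<in>V. m i * g' i) \<le> (\<Sum>i\<in>V. \<Sum>j\<in>V. a i j * \<bar>g' i - g' j\<bar>)"
      using less.hyps by blast
    let ?I = "\<lambda>i. if i \<in> S then 1 else 0 :: real"
    have S_V: "S \<subseteq> V" using S assms(2) by blast
    have g_eq: "g i = g' i + c * ?I i" for i
      by (auto simp: g'_def S_def)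
    have "\<bar>g i - g j\<bar> = \<bar>g' i - g' j\<bar> + c * \<bar>?I i - ?I j\<bar>" for i j
      using c_le[of i] c_le[of j] c_pos by (auto simp: g'_def S_def)
    then have "(\<Sum>i\<in>V. \<Sum>j\<in>V. a i j * \<bar>g i - g j\<bar>) =
        (\<Sum>i\<in>V. \<Sum>j\<in>V. a i j * \<bar>g' i - g' j\<bar>) + c * (\<Sum>i\<in>V. \<Sum>j\<in>V. a i j * \<bar>?I i - ?I j\<bar>)"
      by (simp add: algebra_simps sum.distrib sum_distrib_left)
    \<comment> \<open>Each boundary pair is met in both orders, hence the factor 2.\<close>
    moreover have "(\<Sum>i\<in>V. \<Sum>j\<in>V. a i j * \<bar>?I i - ?I j\<bar>) = 2 * (\<Sum>i\<in>S. \<Sum>j\<in>V - S. a i j)"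
    proof -
      have split: "(\<Sum>i\<in>V. F i) = (\<Sum>i\<in>S. F i) + (\<Sum>i\<in>V - S. F i)" for F :: "'a \<Rightarrow> real"
        using sum.subset_diff[OF S_V assms(1), of F] by simp
      have "(\<Sum>i\<in>V. \<Sum>j\<in>V. a i j * \<bar>?I i - ?I j\<bar>) =
          (\<Sum>i\<in>S. \<Sum>j\<in>V - S. a i j) + (\<Sum>i\<in>V - S. \<Sum>j\<in>S. a i j)"
        by (simp add: split)
      also have "(\<Sum>i\<in>V - S. \<Sum>j\<in>S. a i j) = (\<Sum>i\<in>S. \<Sum>j\<in>V - S. a i j)"
        by (subst sum.swap) (simp add: assms(3))
      finally show ?thesis by simp
    qed
    moreover have "(\<Sum>i\<in>V. m i * g i) = (\<Sum>i\<in>V. m i * g' i) + c * sum m S"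
    proof -
      have "(\<Sum>i\<in>V. m i * g i) = (\<Sum>i\<in>V. m i * g' i) + c * (\<Sum>i\<in>V. m i * ?I i)"
        by (simp add: g_eq algebra_simps sum.distrib sum_distrib_left)
      also have "(\<Sum>i\<in>V. m i * ?I i) = sum m S"
        using S_V assms(1) by (simp add: if_distrib sum.If_cases Int_absorb1 cong: if_cong)
      finally show ?thesis .
    qed
    moreover have "c * (h * sum m S) \<le> c * (\<Sum>i\<in>S. \<Sum>j\<in>V - S. a i j)"
      using cut[OF S(1) False] c_pos by (intro mult_left_mono) auto
    ultimately show ?thesis
      using IH by (simp add: algebra_simps)
  qed
qed

section \<open>The quadratic form of a weighted graph\<close>

text \<open>These are the entries of \<open>D + K - A\<close>. The measure is left out to keep the
  matrix symmetric and enters through weighted norms instead.\<close>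

definition schroedinger :: "wgraph \<Rightarrow> nat \<Rightarrow> nat \<Rightarrow> real" where
  "schroedinger G i j = (if i = j then wdegree G i + potential G i else 0) - adj_weight G i j"

lemma adj_weight_sym: "adj_weight G i j = adj_weight G j i"
  by (simp add: adj_weight_def insert_commute)

lemma finite_verts [simp]: "finite (verts G)"
  by (simp add: verts_def)

lemma edge_verts:
  assumes "weighted_graph G" "{i, j} \<in> edges G"
  shows "i \<in> verts G" "j \<in> verts G" "i \<noteq> j"
  using assms by (auto simp: weighted_graph_def dest!: bspec[where x = "{i, j}"])

lemma adj_weight_nonneg: "weighted_graph G \<Longrightarrow> adj_weight G i j \<ge> 0"
  by (force simp: weighted_graph_def adj_weight_def less_imp_le)

lemma wdegree_eq_sum:
  assumes "weighted_graph G"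
  shows "wdegree G i = (\<Sum>j\<in>verts G. adj_weight G i j)"
proof -
  have "(\<Sum>j\<in>verts G. adj_weight G i j) = (\<Sum>j\<in>{j \<in> verts G. {i, j} \<in> edges G}. weight G {i, j})"
    unfolding adj_weight_def by (rule sum.inter_filter[symmetric]) simp
  also have "{j \<in> verts G. {i, j} \<in> edges G} = {j. {i, j} \<in> edges G}"
    using edge_verts[OF assms] by blast
  finally show ?thesis by (simp add: wdegree_def)
qed

lemma wdegree_le_tau:
  assumes "weighted_graph G" "i \<in> verts G"
  shows "wdegree G i \<le> tau G * vmeasure G i"
proof -
  have "wdegree G i / vmeasure G i \<le> tau G"
    unfolding tau_def using assms by (intro Max_ge) auto
  moreover have "vmeasure G i > 0"
    using assms by (auto simp: weighted_graph_def)
  ultimately show ?thesis by (simp add: field_simps)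
qed

text \<open>Summation by parts; the double sum meets every edge in both orders, hence the factors
  2.\<close>

lemma schroedinger_form_eq:
  assumes "weighted_graph G"
  shows "2 * qform (verts G) (schroedinger G) f =
    (\<Sum>i\<in>verts G. \<Sum>j\<in>verts G. adj_weight G i j * (f i - f j)\<^sup>2) +
    2 * (\<Sum>i\<in>verts G. potential G i * (f i)\<^sup>2)"
proof -
  let ?V = "verts G" and ?a = "adj_weight G"
  let ?D = "\<Sum>i\<in>?V. wdegree G i * (f i)\<^sup>2" and ?A = "\<Sum>i\<in>?V. \<Sum>j\<in>?V. ?a i j * f i * f j"
  have D1: "(\<Sum>i\<in>?V. \<Sum>j\<in>?V. ?a i j * (f i)\<^sup>2) = ?D"
    by (simp add: wdegree_eq_sum[OF assms] sum_distrib_right)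
  then have D2: "(\<Sum>i\<in>?V. \<Sum>j\<in>?V. ?a i j * (f j)\<^sup>2) = ?D"
    by (subst sum.swap) (simp add: adj_weight_sym)
  have "(\<Sum>i\<in>?V. \<Sum>j\<in>?V. ?a i j * (f i - f j)\<^sup>2) =
      (\<Sum>i\<in>?V. \<Sum>j\<in>?V. ?a i j * (f i)\<^sup>2) + (\<Sum>i\<in>?V. \<Sum>j\<in>?V. ?a i j * (f j)\<^sup>2) - 2 * ?A"
    by (simp add: power2_diff algebra_simps sum.distrib sum_subtractf sum_distrib_left)
  moreover have "qform ?V (schroedinger G) f =
      ?D + (\<Sum>i\<in>?V. potential G i * (f i)\<^sup>2) - ?A"
  proof -
    have eq: "schroedinger G i j * f i * f j =
        (if j = i then (wdegree G i + potential G i) * (f i)\<^sup>2 else 0) - ?a i j * f i * f j" for i j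
      by (simp add: schroedinger_def power2_eq_square algebra_simps)
    show ?thesis
      unfolding qform_def eq by (simp add: sum_subtractf sum.distrib distrib_right)
  qed
  ultimately show ?thesis using D1 D2 by simp
qed

text \<open>Bounding the square of a sum by twice the sum of squares leaves only degree sums. This
  controls the second Cauchy-Schwarz factor in the Cheeger argument.\<close>

lemma adj_weight_sum_squares_le:
  assumes "weighted_graph G"
  shows "(\<Sum>i\<in>verts G. \<Sum>j\<in>verts G. adj_weight G i j * (f i + f j)\<^sup>2)
    \<le> 4 * tau G * (\<Sum>i\<in>verts G. vmeasure G i * (f i)\<^sup>2)"
proof -
  let ?V = "verts G" and ?a = "adj_weight G"
  let ?D = "\<Sum>i\<in>?V. wdegree G i * (f i)\<^sup>2"
  have D1: "(\<Sum>i\<in>?V. \<Sum>j\<in>?V. ?a i j * (f i)\<^sup>2) = ?D"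
    by (simp add: wdegree_eq_sum[OF assms] sum_distrib_right)
  then have D2: "(\<Sum>i\<in>?V. \<Sum>j\<in>?V. ?a i j * (f j)\<^sup>2) = ?D"
    by (subst sum.swap) (simp add: adj_weight_sym)
  have "(\<Sum>i\<in>?V. \<Sum>j\<in>?V. ?a i j * (f i + f j)\<^sup>2)
      \<le> (\<Sum>i\<in>?V. \<Sum>j\<in>?V. 2 * (?a i j * (f i)\<^sup>2) + 2 * (?a i j * (f j)\<^sup>2))"
  proof (intro sum_mono)
    fix i j
    have "(f i + f j)\<^sup>2 \<le> 2 * (f i)\<^sup>2 + 2 * (f j)\<^sup>2"
      using zero_le_power2[of "f i - f j"] by (simp add: power2_sum power2_diff)
    from mult_left_mono[OF this adj_weight_nonneg[OF assms, of i j]]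
    show "?a i j * (f i + f j)\<^sup>2 \<le> 2 * (?a i j * (f i)\<^sup>2) + 2 * (?a i j * (f j)\<^sup>2)"
      by (simp add: algebra_simps)
  qed
  also have "\<dots> = 4 * ?D"
    using D1 D2 by (simp add: sum.distrib flip: sum_distrib_left)
  also have "?D \<le> (\<Sum>i\<in>?V. tau G * vmeasure G i * (f i)\<^sup>2)"
    by (intro sum_mono mult_right_mono wdegree_le_tau[OF assms]) auto
  finally show ?thesis by (simp add: sum_distrib_left algebra_simps)
qed

text \<open>The least conductance \<open>h\<close> among nonempty subsets of \<open>U\<close>
  satisfies the cut condition of \<open>coarea_inequality\<close>. Apply that to the square of
  \<open>f\<close>, so the sign of \<open>f\<close> does not matter, factor the differences of
  squares and use Cauchy-Schwarz.\<close>

lemma dirichlet_cheeger_inequality: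
  assumes G: "weighted_graph G" "\<forall>i\<in>verts G. potential G i \<ge> 0"
    and f: "nonzero_supported f U" "U \<subseteq> verts G"
    and Q: "qform (verts G) (schroedinger G) f \<le> t * (\<Sum>i\<in>verts G. vmeasure G i * (f i)\<^sup>2)"
  shows "\<exists>S\<subseteq>U. S \<noteq> {} \<and> conductance G S \<le> sqrt (2 * tau G * t)"
proof -
  let ?V = "verts G" and ?a = "adj_weight G"
  define N where "N = (\<Sum>i\<in>?V. vmeasure G i * (f i)\<^sup>2)"
  have \<mu>: "vmeasure G i > 0" if "i \<in> ?V" for i using G that by (auto simp: weighted_graph_def)
  obtain i0 where i0: "f i0 \<noteq> 0" "i0 \<in> U" using f(1) by (auto simp: nonzero_supported_def)
  have "N > 0"
    unfolding N_def using i0 f(2) \<mu> by (intro sum_pos2[of _ i0]) (auto simp: less_imp_le)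
  have "finite U" using f(2) finite_verts finite_subset by blast
  define \<Phi> where "\<Phi> = conductance G ` (Pow U - {{}})"
  have \<Phi>: "finite \<Phi>" "\<Phi> \<noteq> {}" using \<open>finite U\<close> i0 by (auto simp: \<Phi>_def)
  define h where "h = Min \<Phi>"
  have "h \<in> \<Phi>" using \<Phi> by (simp add: h_def)
  then obtain S where S: "S \<subseteq> U" "S \<noteq> {}" "conductance G S = h" by (auto simp: \<Phi>_def)
  have "2 * h * (\<Sum>i\<in>?V. vmeasure G i * (f i)\<^sup>2) \<le> (\<Sum>i\<in>?V. \<Sum>j\<in>?V. ?a i j * \<bar>(f i)\<^sup>2 - (f j)\<^sup>2\<bar>)"
  proof (rule coarea_inequality[where U = U])
    fix T assume T: "T \<subseteq> U" "T \<noteq> {}"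
    have "h \<le> conductance G T"
      unfolding h_def using T \<Phi> by (intro Min_le) (auto simp: \<Phi>_def)
    moreover have "sum (vmeasure G) T > 0"
      using T f(2) \<mu> \<open>finite U\<close> by (intro sum_pos) (auto intro: finite_subset)
    ultimately show "h * sum (vmeasure G) T \<le> (\<Sum>i\<in>T. \<Sum>j\<in>?V - T. ?a i j)"
      by (simp add: conductance_def field_simps)
  qed (use f in \<open>auto simp: adj_weight_sym nonzero_supported_def\<close>)
  also have "\<dots> = (\<Sum>(i, j)\<in>?V \<times> ?V. \<bar>sqrt (?a i j) * (f i - f j)\<bar> * \<bar>sqrt (?a i j) * (f i + f j)\<bar>)"
  proof -
    have "?a i j * \<bar>(f i)\<^sup>2 - (f j)\<^sup>2\<bar> =
        \<bar>sqrt (?a i j) * (f i - f j)\<bar> * \<bar>sqrt (?a i j) * (f i + f j)\<bar>" for i j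
    proof -
      have "\<bar>sqrt (?a i j) * (f i - f j)\<bar> * \<bar>sqrt (?a i j) * (f i + f j)\<bar> =
          \<bar>(sqrt (?a i j) * sqrt (?a i j)) * ((f i - f j) * (f i + f j))\<bar>"
        by (simp add: abs_mult ac_simps)
      also have "\<dots> = ?a i j * \<bar>(f i)\<^sup>2 - (f j)\<^sup>2\<bar>"
        unfolding square_diff_square_factored[symmetric] power2_eq_square mult.commute[of "f i - f j"]
        using adj_weight_nonneg[OF G(1), of i j] by (simp add: abs_mult)
      finally show ?thesis by simp
    qed
    then show ?thesis by (simp add: sum.cartesian_product)
  qed
  also have "\<dots> \<le> L2_set (\<lambda>(i, j). sqrt (?a i j) * (f i - f j)) (?V \<times> ?V) *
      L2_set (\<lambda>(i, j). sqrt (?a i j) * (f i + f j)) (?V \<times> ?V)"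
    using L2_set_mult_ineq[of "\<lambda>(i, j). sqrt (?a i j) * (f i - f j)"
        "\<lambda>(i, j). sqrt (?a i j) * (f i + f j)" "?V \<times> ?V"]
    by (simp add: case_prod_unfold)
  also have "\<dots> = sqrt (\<Sum>i\<in>?V. \<Sum>j\<in>?V. ?a i j * (f i - f j)\<^sup>2) *
      sqrt (\<Sum>i\<in>?V. \<Sum>j\<in>?V. ?a i j * (f i + f j)\<^sup>2)"
    using adj_weight_nonneg[OF G(1)]
    by (simp add: L2_set_def case_prod_unfold power_mult_distrib sum.cartesian_product)
  also have "\<dots> \<le> sqrt (2 * t * N) * sqrt (4 * tau G * N)"
  proof (intro mult_mono real_sqrt_le_mono)
    \<comment> \<open>Nonnegativity of the potential allows its term to be dropped from the
      form.\<close>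
    have "0 \<le> (\<Sum>i\<in>?V. potential G i * (f i)\<^sup>2)"
      using G(2) by (intro sum_nonneg) auto
    then show le: "(\<Sum>i\<in>?V. \<Sum>j\<in>?V. ?a i j * (f i - f j)\<^sup>2) \<le> 2 * t * N"
      using Q schroedinger_form_eq[OF G(1), of f] by (simp add: N_def)
    have "0 \<le> (\<Sum>i\<in>?V. \<Sum>j\<in>?V. ?a i j * (f i - f j)\<^sup>2)"
      using adj_weight_nonneg[OF G(1)] by (simp add: sum_nonneg)
    then show "0 \<le> sqrt (2 * t * N)"
      using le by (intro real_sqrt_ge_zero) (rule order_trans)
    show "(\<Sum>i\<in>?V. \<Sum>j\<in>?V. ?a i j * (f i + f j)\<^sup>2) \<le> 4 * tau G * N"
      unfolding N_def by (rule adj_weight_sum_squares_le[OF G(1)])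
    show "0 \<le> sqrt (\<Sum>i\<in>?V. \<Sum>j\<in>?V. ?a i j * (f i + f j)\<^sup>2)"
      using adj_weight_nonneg[OF G(1)] by (simp add: sum_nonneg)
  qed
  also have "\<dots> = 2 * sqrt (2 * tau G * t) * N"
  proof -
    have "sqrt (2 * t * N) * sqrt (4 * tau G * N) = sqrt ((2 * N)\<^sup>2 * (2 * tau G * t))"
      by (simp add: power2_eq_square ac_simps flip: real_sqrt_mult)
    also have "\<dots> = 2 * N * sqrt (2 * tau G * t)"
      using \<open>N > 0\<close> real_sqrt_unique[of "2 * N" "(2 * N)\<^sup>2"]
      by (subst real_sqrt_mult) (simp del: power_mult_distrib)
    finally show ?thesis by simp
  qed
  finally have "h \<le> sqrt (2 * tau G * t)"
    using \<open>N > 0\<close> unfolding N_def by simp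
  then show ?thesis using S by blast
qed

section \<open>Forests in graphs and the main theorem\<close>

text \<open>Conjugation by the square root of \<open>M\<close> turns the Laplacian into the
  symmetric matrix \<open>B\<close> with the same characteristic polynomial. Diagonal rescaling also
  preserves the zeros of a vector, so the vanishing conditions carry over.\<close>

lemma laplacian_small_form_vanishing_on:
  assumes G: "weighted_graph G" and C: "C \<subseteq> verts G" "card C < k" and k: "k \<le> card (verts G)"
  shows "\<exists>f. nonzero_supported f (verts G - C) \<and>
    qform (verts G) (schroedinger G) f \<le> lambda G k * (\<Sum>i\<in>verts G. vmeasure G i * (f i)\<^sup>2)"
proof -
  define n where "n = num_verts G"
  have V: "verts G = {..<n}" by (auto simp: verts_def n_def)
  have \<mu>: "vmeasure G i > 0" if "i < n" for i
    using G that unfolding weighted_graph_def V by auto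
  define s where "s i = sqrt (vmeasure G i)" for i
  have s: "s i > 0" "s i * s i = vmeasure G i" if "i < n" for i
    using \<mu>[OF that] by (auto simp: s_def)
  define B where "B = mat n n (\<lambda>(i, j). schroedinger G i j / (s i * s j))"
  have B: "B \<in> carrier_mat n n" by (simp add: B_def)
  have "B\<^sup>T = B"
    by (rule eq_matI) (auto simp: B_def schroedinger_def adj_weight_sym)
  define L where "L = normalized_laplacian G"
  have H: "degree_mat G + potential_mat G - adjacency_mat G = mat n n (\<lambda>(i, j). schroedinger G i j)"
    by (rule eq_matI)
      (auto simp: degree_mat_def potential_mat_def adjacency_mat_def mat_diag_def n_def schroedinger_def)
  have L: "L = mat n n (\<lambda>(i, j). schroedinger G i j / vmeasure G i)"
    unfolding L_def normalized_laplacian_def H measure_mat_inv_def n_def[symmetric]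
    by (subst mat_diag_mult_left[of _ n n]) (auto intro!: eq_matI)
  have sim: "L = mat_diag n (\<lambda>i. 1 / s i) * B * mat_diag n s"
    unfolding mat_diag_mult_left[OF B]
    by (subst mat_diag_mult_right[of _ n n])
      (use s in \<open>auto simp: L B_def less_imp_neq[symmetric] mult.commute intro!: eq_matI\<close>)
  have inv: "mat_diag n (\<lambda>i. 1 / s i) * mat_diag n s = 1\<^sub>m n"
    "mat_diag n s * mat_diag n (\<lambda>i. 1 / s i) = 1\<^sub>m n"
    unfolding mat_diag_diag using s(1)
    by (auto simp: mat_diag_def less_imp_neq[symmetric] intro!: eq_matI)
  have "L \<in> carrier_mat n n" by (simp add: L)
  then have "similar_mat_wit L B (mat_diag n (\<lambda>i. 1 / s i)) (mat_diag n s)"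
    by (rule similar_mat_witI[OF inv sim _ B]) auto
  then have "similar_mat L B" by (auto simp: similar_mat_def)
  then have "char_poly L = char_poly B" by (rule char_poly_similar)
  then have \<lambda>: "lambda G k = sorted_list_of_multiset (proots (char_poly B)) ! (k - 1)"
    by (simp add: lambda_def eigenvalue_list_def L_def)
  obtain x where x: "\<exists>i<n. x i \<noteq> 0" "\<forall>i\<in>C. x i = 0"
    "(\<Sum>i<n. \<Sum>j<n. B $$ (i, j) * x i * x j) \<le> lambda G k * (\<Sum>i<n. (x i)\<^sup>2)"
    using small_quadratic_form_vanishing_on[OF B \<open>B\<^sup>T = B\<close> _ C(2)] C(1) k unfolding V \<lambda> by auto
  \<comment> \<open>Dividing by \<open>s\<close> turns the Euclidean norm of \<open>x\<close> into
    the \<open>vmeasure\<close>-weighted norm of \<open>f\<close>. The extension by 0 is needed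
    because \<open>nonzero_supported\<close> looks at all natural numbers.\<close>
  define f where "f i = (if i < n then x i / s i else 0)" for i
  show ?thesis
  proof (intro exI[of _ f] conjI)
    show "nonzero_supported f (verts G - C)"
      using x(1,2) s(1) by (force simp: nonzero_supported_def f_def V)
    have "qform (verts G) (schroedinger G) f = (\<Sum>i<n. \<Sum>j<n. B $$ (i, j) * x i * x j)"
      unfolding qform_def V by (intro sum.cong) (auto simp: f_def B_def)
    moreover have "(\<Sum>i\<in>verts G. vmeasure G i * (f i)\<^sup>2) = (\<Sum>i<n. (x i)\<^sup>2)"
      unfolding V
    proof (intro sum.cong refl)
      fix i assume "i \<in> {..<n}"
      then show "vmeasure G i * (f i)\<^sup>2 = (x i)\<^sup>2"
        using s[of i] \<mu>[of i] by (auto simp: f_def power2_eq_square divide_simps)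
    qed
    ultimately show "qform (verts G) (schroedinger G) f
        \<le> lambda G k * (\<Sum>i\<in>verts G. vmeasure G i * (f i)\<^sup>2)"
      using x(3) by simp
  qed
qed

section \<open>Distance orderings and the cyclomatic number\<close>

text \<open>The predecessor of \<open>v\<close> on a shortest path from the root 0 is closer to the
  root, hence earlier.\<close>

lemma exists_distance_ordering:
  assumes G: "weighted_graph G" "connected_graph G"
  shows "\<exists>r :: nat \<Rightarrow> nat. inj_on r (verts G) \<and>
    (\<forall>v\<in>verts G - {0}. \<exists>u. r u < r v \<and> {u, v} \<in> edges G) \<and> (\<forall>v\<in>verts G. r 0 \<le> r v)"
proof -
  define n where "n = num_verts G"
  define E where "E = {(u, v). {u, v} \<in> edges G}"
  define d where "d v = (LEAST m. (0, v) \<in> E ^^ m)" for v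
  have V: "verts G = {..<n}" by (auto simp: verts_def n_def)
  have "0 \<in> verts G" using G(1) unfolding weighted_graph_def V by auto
  then have reach: "\<exists>m. (0, v) \<in> E ^^ m" if "v \<in> verts G" for v
    using G(2) that by (auto simp: connected_graph_def E_def rtrancl_power)
  have d: "(0, v) \<in> E ^^ d v" if "v \<in> verts G" for v
    unfolding d_def using reach[OF that] by (rule LeastI_ex)
  \<comment> \<open>Lexicographic order by distance and then label, written in base
    \<open>n\<close>; the label is the last digit, which makes \<open>r\<close> injective.\<close>
  define r where "r v = d v * n + v" for v
  have r_less: "r u < r v" if "d u < d v" "u \<in> verts G" for u v
  proof -
    have "r u < Suc (d u) * n" using that(2) by (simp add: r_def V)
    also have "\<dots> \<le> d v * n" using that(1) by (intro mult_le_mono1) simp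
    finally show ?thesis by (simp add: r_def)
  qed
  have "d 0 = 0" unfolding d_def by (rule Least_eq_0) simp
  show ?thesis
  proof (intro exI[of _ r] conjI ballI)
    show "inj_on r (verts G)"
    proof (rule inj_onI)
      fix u v assume uv: "u \<in> verts G" "v \<in> verts G" "r u = r v"
      then have "r u mod n = r v mod n" by simp
      then show "u = v" using uv by (simp add: r_def V)
    qed
    show "\<exists>u. r u < r v \<and> {u, v} \<in> edges G" if "v \<in> verts G - {0}" for v
    proof -
      have v: "(0, v) \<in> E ^^ d v" "v \<noteq> 0" using d that by auto
      then obtain m where m: "d v = Suc m" by (cases "d v") auto
      then obtain u where u: "(0, u) \<in> E ^^ m" "(u, v) \<in> E" using v(1) by auto
      have "d u \<le> m" unfolding d_def using u(1) by (rule Least_le)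
      then have "r u < r v" using m u(2) edge_verts[OF G(1)] by (intro r_less) (auto simp: E_def)
      then show ?thesis using u(2) by (auto simp: E_def)
    qed
    show "r 0 \<le> r v" if "v \<in> verts G" for v
      using \<open>d 0 = 0\<close> by (simp add: r_def)
  qed
qed

text \<open>Each edge is counted exactly once, at its later endpoint.\<close>

lemma card_edges_eq_sum_earlier:
  fixes r :: "nat \<Rightarrow> nat"
  assumes G: "weighted_graph G" and r: "inj_on r (verts G)"
  shows "card (edges G) = (\<Sum>v\<in>verts G. card {u. r u < r v \<and> {u, v} \<in> edges G})"
proof -
  let ?N = "\<lambda>v. {u. r u < r v \<and> {u, v} \<in> edges G}"
  have fin: "finite (?N v)" for v
    by (rule finite_subset[OF _ finite_verts[of G]]) (use edge_verts[OF G] in auto)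
  have "edges G = (\<Union>v\<in>verts G. (\<lambda>u. {u, v}) ` ?N v)"
  proof (intro equalityI subsetI)
    fix e assume e: "e \<in> edges G"
    then obtain u v where uv: "e = {u, v}" "u \<noteq> v"
      using G by (metis card_2_iff weighted_graph_def)
    then have "u \<in> verts G" "v \<in> verts G" using e edge_verts[OF G] by auto
    then consider "r u < r v" | "r v < r u" using r uv(2) by (metis inj_onD linorder_neqE_nat)
    then show "e \<in> (\<Union>v\<in>verts G. (\<lambda>u. {u, v}) ` ?N v)"
    proof cases
      case 1
      then have "u \<in> ?N v" using e uv(1) by simp
      then show ?thesis unfolding uv(1) by (intro UN_I[OF \<open>v \<in> verts G\<close>] imageI)
    next
      case 2
      then have "v \<in> ?N u" using e uv(1) by (simp add: insert_commute)
      then show ?thesis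
        unfolding uv(1) insert_commute[of u v] by (intro UN_I[OF \<open>u \<in> verts G\<close>] imageI)
    qed
  qed auto
  moreover have "card (\<Union>v\<in>verts G. (\<lambda>u. {u, v}) ` ?N v) = (\<Sum>v\<in>verts G. card ((\<lambda>u. {u, v}) ` ?N v))"
    by (rule card_UN_disjoint) (use fin in \<open>auto simp: doubleton_eq_iff\<close>)
  moreover have "card ((\<lambda>u. {u, v}) ` ?N v) = card (?N v)" for v
    by (intro card_image inj_onI) (auto simp: doubleton_eq_iff)
  ultimately show ?thesis by simp
qed

text \<open>Count edges at their later endpoints: every vertex but the root contributes at least 1
  and every vertex of \<open>F\<close> at least 2. Thus the number of edges is at least
  \<open>card (verts G) - 1 + card F\<close>.\<close>

lemma forest_after_deleting:
  assumes G: "weighted_graph G" "connected_graph G"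
  shows "\<exists>(r :: nat \<Rightarrow> nat) F. inj_on r (verts G) \<and> F \<subseteq> verts G \<and> int (card F) \<le> cyclomatic_number G \<and>
    (\<forall>v\<in>verts G - F. card {u. r u < r v \<and> {u, v} \<in> edges G} \<le> 1)"
proof -
  obtain r :: "nat \<Rightarrow> nat" where r: "inj_on r (verts G)"
    "\<forall>v\<in>verts G - {0}. \<exists>u. r u < r v \<and> {u, v} \<in> edges G" "\<forall>v\<in>verts G. r 0 \<le> r v"
    using exists_distance_ordering[OF G] by blast
  let ?N = "\<lambda>v. {u. r u < r v \<and> {u, v} \<in> edges G}"
  have fin: "finite (?N v)" for v
    by (rule finite_subset[OF _ finite_verts[of G]]) (use edge_verts[OF G(1)] in auto)
  have "0 \<in> verts G" using G(1) by (auto simp: weighted_graph_def verts_def)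
  define F where "F = {v \<in> verts G. card (?N v) > 1}"
  \<comment> \<open>The root has minimal rank and therefore no earlier neighbour, which keeps it out
    of \<open>F\<close>.\<close>
  have N0: "?N 0 = {}" using r(3) edge_verts[OF G(1)] by fastforce
  have F: "F \<subseteq> verts G - {0}"
    unfolding F_def using N0 by (auto simp del: Collect_empty_eq)
  have "card (verts G) - 1 + card F = (\<Sum>v\<in>verts G - {0}. 1 + (if v \<in> F then 1 else 0))"
  proof -
    have "(\<Sum>v\<in>verts G - {0}. if v \<in> F then 1 else 0 :: nat) = card F"
      using F by (simp add: sum.If_cases Int_absorb1)
    then show ?thesis using \<open>0 \<in> verts G\<close> by (simp only: sum.distrib) simp
  qed
  also have "\<dots> \<le> (\<Sum>v\<in>verts G - {0}. card (?N v))"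
  proof (rule sum_mono)
    fix v assume v: "v \<in> verts G - {0}"
    then have "?N v \<noteq> {}" using r(2) by blast
    then have "card (?N v) > 0" using fin card_gt_0_iff by blast
    then show "1 + (if v \<in> F then 1 else 0) \<le> card (?N v)"
      by (auto simp: F_def)
  qed
  also have "\<dots> \<le> card (edges G)"
    unfolding card_edges_eq_sum_earlier[OF G(1) r(1)] by (intro sum_mono2) auto
  finally have "card (verts G) - 1 + card F \<le> card (edges G)" .
  then have "int (card F) \<le> cyclomatic_number G"
    using \<open>0 \<in> verts G\<close> by (simp add: cyclomatic_number_def)
  moreover have "\<forall>v\<in>verts G - F. card (?N v) \<le> 1" by (auto simp: F_def)
  ultimately show ?thesis using r(1) F by blast
qed

section \<open>From disjoint sets to the Cheeger constant\<close>

lemma cheeger_le: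
  assumes "disjoint_family_on A C" "finite C" "m \<le> card C" "m \<ge> 1"
    and "\<And>c. c \<in> C \<Longrightarrow> A c \<noteq> {} \<and> A c \<subseteq> verts G \<and> conductance G (A c) \<le> b"
  shows "cheeger G m \<le> b"
proof -
  obtain C' where C': "C' \<subseteq> C" "card C' = m"
    using assms(2,3) by (metis obtain_subset_with_card_n)
  then have "finite C'" using assms(2) finite_subset by blast
  then obtain g where g: "bij_betw g {1..m} C'"
    using finite_same_card_bij[of "{1..m}" C'] C'(2) by auto
  have gC: "g i \<in> C" if "i \<in> {1..m}" for i
    using g C'(1) that by (auto simp: bij_betw_def)
  \<comment> \<open>Tuples in \<open>disjoint_tuples\<close> are extensional functions, hence the
    restriction to the index range.\<close>
  define T where "T = restrict (A \<circ> g) {1..m}"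
  have "disjoint_family_on T {1..m}"
    unfolding disjoint_family_on_def
  proof (intro ballI impI)
    fix i j assume ij: "i \<in> {1..m}" "j \<in> {1..m}" "i \<noteq> j"
    then have "g i \<noteq> g j" using g by (auto simp: bij_betw_def dest: inj_onD)
    then show "T i \<inter> T j = {}"
      using assms(1) ij gC by (simp add: T_def disjoint_family_on_def)
  qed
  then have T: "T \<in> disjoint_tuples G m"
    using assms(5) gC unfolding disjoint_tuples_def by (auto simp: T_def)
  have fin: "finite (disjoint_tuples G m)"
    unfolding disjoint_tuples_def
    by (rule finite_subset[OF _ finite_PiE[of "{1..m}" "\<lambda>_. Pow (verts G) - {{}}"]]) auto
  have "cheeger G m \<le> Max ((\<lambda>i. conductance G (T i)) ` {1..m})"
    unfolding cheeger_def using T fin by (intro Min_le) auto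
  also have "\<dots> \<le> b"
    using assms(4,5) gC by (intro Max.boundedI) (auto simp: T_def)
  finally show ?thesis .
qed

theorem theorem3p1:
  fixes G :: wgraph and k :: nat
  assumes "weighted_graph G"
    and "connected_graph G"
    and "\<forall>i\<in>verts G. potential G i \<ge> 0"
    and "cyclomatic_number G + 1 \<le> int k"
    and "k \<le> card (verts G)"
  shows "cheeger G (nat (int k - cyclomatic_number G)) \<le> sqrt (2 * tau G * lambda G k)"
proof -
  define t where "t = lambda G k"
  \<comment> \<open>The form of \<open>b\<close> is nonpositive exactly on functions whose energy is
    at most \<open>t\<close> times their weighted squared norm.\<close>
  define b where "b i j = schroedinger G i j - (if i = j then t * vmeasure G i else 0)" for i j
  have b_sym: "b i j = b j i" for i j
    by (simp add: b_def schroedinger_def adj_weight_sym)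
  have qb: "qform (verts G) b f =
      qform (verts G) (schroedinger G) f - t * (\<Sum>i\<in>verts G. vmeasure G i * (f i)\<^sup>2)" for f
  proof -
    have eq: "b i j * f i * f j = schroedinger G i j * f i * f j -
        (if j = i then t * (vmeasure G i * (f i)\<^sup>2) else 0)" for i j
      by (simp add: b_def algebra_simps power2_eq_square)
    show ?thesis
      unfolding qform_def eq by (simp add: sum_subtractf sum_distrib_left)
  qed
  obtain r :: "nat \<Rightarrow> nat" and F where r: "inj_on r (verts G)"
    and F: "F \<subseteq> verts G" "int (card F) \<le> cyclomatic_number G"
      "\<forall>v\<in>verts G - F. card {u. r u < r v \<and> {u, v} \<in> edges G} \<le> 1"
    using forest_after_deleting[OF assms(1,2)] by blast
  define W where "W = verts G - F"
  \<comment> \<open>Off the diagonal \<open>b\<close> is nonzero only on edges, so the forest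
    property of \<open>W\<close> passes to \<open>b\<close>.\<close>
  have earlier: "card {u \<in> W. r u < r v \<and> b u v \<noteq> 0} \<le> 1" if "v \<in> W" for v
  proof -
    have "{u \<in> W. r u < r v \<and> b u v \<noteq> 0} \<subseteq> {u. r u < r v \<and> {u, v} \<in> edges G}"
      by (auto simp: b_def schroedinger_def adj_weight_def split: if_splits)
    moreover have "finite {u. r u < r v \<and> {u, v} \<in> edges G}"
      by (rule finite_subset[OF _ finite_verts[of G]]) (use edge_verts[OF assms(1)] in auto)
    ultimately have "card {u \<in> W. r u < r v \<and> b u v \<noteq> 0} \<le> card {u. r u < r v \<and> {u, v} \<in> edges G}"
      by (intro card_mono)
    also have "\<dots> \<le> 1" using F(3) that unfolding W_def by blast
    finally show ?thesis .
  qed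
  have "finite W" "inj_on r W" using r by (auto simp: W_def intro: inj_on_subset)
  then obtain C U where C: "C \<subseteq> W" "disjoint_family_on U C"
    "\<forall>c\<in>C. U c \<subseteq> W \<and> (\<exists>f. nonzero_supported f (U c) \<and> qform (verts G) b f \<le> 0)"
    "\<forall>f. nonzero_supported f (W - C) \<longrightarrow> qform (verts G) b f > 0"
    using disjoint_test_functions[of b W r "verts G", OF b_sym _ _ earlier] by blast
  have "finite C" using C(1) \<open>finite W\<close> finite_subset by blast
  \<comment> \<open>Otherwise the eigenvalue bound would give a nonzero function with nonpositive
    form vanishing on \<open>F\<close> and \<open>C\<close>, where positivity is already
    known.\<close>
  have "k \<le> card (F \<union> C)"
  proof (rule ccontr)
    assume "\<not> ?thesis"
    then have "card (F \<union> C) < k" by simp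
    moreover have "F \<union> C \<subseteq> verts G" using F(1) C(1) by (auto simp: W_def)
    ultimately obtain f where f: "nonzero_supported f (verts G - (F \<union> C))"
      "qform (verts G) (schroedinger G) f \<le> t * (\<Sum>i\<in>verts G. vmeasure G i * (f i)\<^sup>2)"
      using laplacian_small_form_vanishing_on[OF assms(1) _ _ assms(5)] unfolding t_def by blast
    have "verts G - (F \<union> C) = W - C" by (auto simp: W_def)
    then have "qform (verts G) b f > 0" using f(1) C(4) by simp
    then show False using f(2) qb[of f] by linarith
  qed
  also have "\<dots> \<le> card F + card C" by (rule card_Un_le)
  finally have card: "nat (int k - cyclomatic_number G) \<le> card C" using F(2) by linarith
  have "\<exists>S\<subseteq>U c. S \<noteq> {} \<and> conductance G S \<le> sqrt (2 * tau G * t)" if c: "c \<in> C" for c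
  proof -
    obtain f where f: "nonzero_supported f (U c)" "qform (verts G) b f \<le> 0" using C(3) c by blast
    have "U c \<subseteq> verts G" using C(3) c by (auto simp: W_def)
    then show ?thesis
      using dirichlet_cheeger_inequality[OF assms(1,3) f(1)] f(2)[unfolded qb] by simp
  qed
  then obtain S where S: "\<And>c. c \<in> C \<Longrightarrow> S c \<subseteq> U c \<and> S c \<noteq> {} \<and> conductance G (S c) \<le> sqrt (2 * tau G * t)"
    by metis
  show ?thesis
    unfolding t_def[symmetric]
  proof (rule cheeger_le[OF _ \<open>finite C\<close> card])
    \<comment> \<open>Each \<open>S c\<close> lies inside \<open>U c\<close>, so disjointness is
      inherited.\<close>
    show "disjoint_family_on S C"
      using C(2) S unfolding disjoint_family_on_def by blast
    show "1 \<le> nat (int k - cyclomatic_number G)" using assms(4) by linarith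
    show "S c \<noteq> {} \<and> S c \<subseteq> verts G \<and> conductance G (S c) \<le> sqrt (2 * tau G * t)" if "c \<in> C" for c
      using S[OF that] C(3) that by (auto simp: W_def)
  qed
qed

end
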